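(* For every integer $r\geq 1$, we have $\zeta_r(s)\sim (r!)^{-s}$ as the real variable $s\to+\infty$. In particular, $\lim_{k\to\infty}\frac{\zeta_r(k+1)}{\zeta_r(k)}=\frac{1}{r!}$, where $k$ runs over positive integers.
   Context: For an integer $r\geq 1$ and real $s>1$, $\zeta_r(s)=\sum_{1\leq m_1<m_2<\cdots<m_r}(m_1m_2\cdots m_r)^{-s}$ (the Euler–Zagier $r$-fold zeta-function with all arguments equal to $s$). The notation $f(s)\sim g(s)$ means $f(s)/g(s)\to 1$. *)

theory Defs
  imports "HOL-Analysis.Analysis" "HOL-Library.Landau_Symbols"
begin

(* The tuples 1 <= m_1 < ... < m_r, represented as lists of length r. *)
definition increasing_tuples :: "nat \<Rightarrow> nat list set" where
  "increasing_tuples r = {m. length m = r \<and> sorted_wrt (<) m \<and> (\<forall>x\<in>set m. 1 \<le> x)}"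

(* The terms are nonnegative, so summation over the unordered index set is the usual sum of the
   multiple series. The series converges for s > 1; where it diverges, infsum returns 0. *)
definition multiple_zeta :: "nat \<Rightarrow> real \<Rightarrow> real" where
  "multiple_zeta r s = (\<Sum>\<^sub>\<infinity>m\<in>increasing_tuples r. real (prod_list m) powr (- s))"

end

theory Submission
  imports Defs "HOL-Real_Asymp.Real_Asymp"
begin

text \<open>Among the tuples \<open>1 \<le> m\<^sub>1 < \<dots> < m\<^sub>r\<close> the product is at least \<open>r!\<close>, with equality only for
  \<open>(1, \<dots>, r)\<close>. All other products are at least \<open>r! + 1\<close>, so for \<open>s \<ge> 2\<close> each of the remaining terms
  is at most \<open>(r! + 1)\<^bsup>2 - s\<^esup>\<close> times the corresponding term of \<open>\<zeta>\<^sub>r(2)\<close>. Hence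
  \<open>1 \<le> \<zeta>\<^sub>r(s) (r!)\<^bsup>s\<^esup> \<le> 1 + C (r! / (r! + 1))\<^bsup>s\<^esup>\<close> with \<open>C\<close> independent of \<open>s\<close>.\<close>

text \<open>The entries of \<open>m\<close> are distinct members of \<open>{1..<x}\<close>, which
  has only \<open>x - 1\<close> elements.\<close>

lemma length_less_of_strictly_increasing:
  fixes m :: "nat list"
  assumes "sorted_wrt (<) (m @ [x])" "\<forall>y\<in>set (m @ [x]). 1 \<le> y"
  shows "length m < x"
proof -
  have "set m \<subseteq> {1..<x}"
    using assms by (auto simp: sorted_wrt_append)
  then have "card (set m) \<le> x - 1"
    using card_mono[of "{1..<x}" "set m"] by simp
  moreover have "distinct m"
    using assms by (simp add: sorted_wrt_append strict_sorted_iff)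
  moreover have "1 \<le> x"
    using assms by simp
  ultimately show ?thesis
    by (simp add: distinct_card)
qed

text \<open>Induction from the right: the last of \<open>n\<close> entries is at least
  \<open>n\<close>, so it supplies the last factor of the factorial. The equality case is carried
  along because it isolates the unique dominant term of the series.\<close>

lemma fact_le_prod_list:
  fixes m :: "nat list"
  assumes "sorted_wrt (<) m" "\<forall>y\<in>set m. 1 \<le> y"
  shows "fact (length m) \<le> prod_list m
    \<and> (prod_list m = fact (length m) \<longrightarrow> m = [1..<Suc (length m)])"
  using assms
proof (induction m rule: rev_induct)
  case Nil
  then show ?case by simp
next
  case (snoc x m)
  have x: "Suc (length m) \<le> x"
    using length_less_of_strictly_increasing[OF snoc.prems] by simp
  have IH: "fact (length m) \<le> prod_list m"
      "prod_list m = fact (length m) \<Longrightarrow> m = [1..<Suc (length m)]"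
    using snoc by (auto simp: sorted_wrt_append)
  have "fact (length m) * Suc (length m) \<le> prod_list m * x"
    using IH(1) x by (rule mult_le_mono)
  moreover have "m @ [x] = [1..<Suc (length (m @ [x]))]"
    if eq: "prod_list m * x = fact (length m) * Suc (length m)"
  proof -
    \<comment> \<open>Lowering \<open>x\<close> to \<open>Suc (length m)\<close> in
      \<open>eq\<close> bounds \<open>prod_list m\<close> from above; the induction hypothesis
      bounds it from below. Cancelling it then determines \<open>x\<close>.\<close>
    have "prod_list m * Suc (length m) \<le> fact (length m) * Suc (length m)"
      using mult_le_mono2[OF x, of "prod_list m"] eq by simp
    then have P: "prod_list m = fact (length m)"
      using IH(1) by (simp only: mult_le_cancel2) simp
    have "x = Suc (length m)"
      using eq unfolding P by (simp only: mult_cancel1) simp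
    with IH(2)[OF P] show ?thesis
      by (metis One_nat_def Suc_eq_plus1 le_add2 length_append_singleton upt_Suc_append)
  qed
  ultimately show ?case
    by (simp add: mult.commute del: upt_Suc)
qed

lemma upt_in_increasing_tuples: "[1..<Suc r] \<in> increasing_tuples r"
  by (simp add: increasing_tuples_def sorted_wrt_upt del: upt_Suc)

lemma prod_list_upt: "prod_list [1..<Suc r] = fact r"
  by (induction r) simp_all

text \<open>Without the ordering condition the sum is the \<open>r\<close>-th power of a single
  series, so induction on the head of the list works. Lists containing 0 do no harm:
  \<open>0 powr - s = 0\<close>.\<close>

lemma prod_list_powr_summable:
  fixes s :: real
  assumes "1 < s"
  shows "(\<lambda>m. real (prod_list m) powr - s) summable_on {m. length m = r}"
proof (induction r)
  case 0
  then show ?case by simp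
next
  case (Suc r)
  let ?S = "{m :: nat list. length m = r}"
  let ?g = "\<lambda>m. real (prod_list m) powr - s"
  have "(\<lambda>n::nat. real n powr - s) summable_on UNIV"
    using assms by (intro norm_summable_imp_summable_on) (simp add: summable_real_powr_iff)
  then have "(\<lambda>n::nat. real n powr - s * infsum ?g ?S) summable_on UNIV"
    by (rule summable_on_cmult_left)
  \<comment> \<open>For nonnegative terms, summability of the inner sums over \<open>m\<close> and
    then of their values over \<open>n\<close> suffices.\<close>
  then have "(\<lambda>(n, m). real n powr - s * ?g m) summable_on (UNIV \<times> ?S)"
    by (rule summable_on_SigmaI[rotated])
       (use Suc in \<open>auto intro!: has_sum_cmult_right has_sum_infsum\<close>)
  moreover have "{m :: nat list. length m = Suc r} = (\<lambda>(n, m). n # m) ` (UNIV \<times> ?S)"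
    by (force simp: length_Suc_conv)
  moreover have "inj_on (\<lambda>(n, m). n # m) (UNIV \<times> ?S)"
    by (auto simp: inj_on_def)
  ultimately show ?case
    by (simp add: summable_on_reindex o_def case_prod_unfold powr_mult)
qed

lemma increasing_tuples_summable:
  fixes s :: real
  assumes "1 < s"
  shows "(\<lambda>m. real (prod_list m) powr - s) summable_on increasing_tuples r"
  using prod_list_powr_summable[OF assms, of r]
  by (rule summable_on_subset_banach) (auto simp: increasing_tuples_def)

lemma multiple_zeta_bounds:
  fixes s :: real
  assumes "2 \<le> s"
  shows "fact r powr - s \<le> multiple_zeta r s"
    and "multiple_zeta r s \<le> fact r powr - s + (fact r + 1) powr (2 - s) * multiple_zeta r 2"
proof -
  let ?T = "increasing_tuples r"
  let ?f = "\<lambda>s m. real (prod_list m) powr - s"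
  define m0 where "m0 = [1..<Suc r]"
  define U where "U = ?T - {m0}"
  have T: "?T = insert m0 U" "m0 \<notin> U"
    using upt_in_increasing_tuples[of r] by (auto simp: U_def m0_def)
  have "?f t summable_on U" if "1 < t" for t
    using increasing_tuples_summable[OF that, of r] by (rule summable_on_subset_banach) (simp add: U_def)
  then have sU: "?f s summable_on U" "?f 2 summable_on U" and sT: "?f 2 summable_on ?T"
    using assms increasing_tuples_summable[of 2] by auto
  have "real (prod_list m0) = fact r"
    unfolding m0_def prod_list_upt by simp
  then have split: "multiple_zeta r s = fact r powr - s + infsum (?f s) U"
    unfolding multiple_zeta_def T(1) using infsum_insert[OF sU(1) T(2)] by simp
  show "fact r powr - s \<le> multiple_zeta r s"
    unfolding split by (simp add: infsum_nonneg)
  have "?f s m \<le> (fact r + 1) powr (2 - s) * ?f 2 m" if "m \<in> U" for m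
  proof -
    have "fact r < prod_list m"
      using that fact_le_prod_list[of m]
      by (auto simp: U_def m0_def increasing_tuples_def order.order_iff_strict)
    then have "fact r + 1 \<le> real (prod_list m)"
      by (metis Suc_eq_plus1 Suc_leI of_nat_1 of_nat_add of_nat_fact of_nat_le_iff)
    moreover have "(0::real) < fact r + 1"
      by (simp add: add_pos_pos)
    \<comment> \<open>Here \<open>2 \<le> s\<close> matters: the exponent is nonpositive, so the
      power decreases in its base.\<close>
    ultimately have "real (prod_list m) powr (2 - s) \<le> (fact r + 1) powr (2 - s)"
      using assms by (intro powr_mono2') auto
    then have "real (prod_list m) powr (2 - s) * ?f 2 m \<le> (fact r + 1) powr (2 - s) * ?f 2 m"
      by (rule mult_right_mono) simp
    then show ?thesis
      by (simp add: powr_add[symmetric])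
  qed
  then have "infsum (?f s) U \<le> infsum (\<lambda>m. (fact r + 1) powr (2 - s) * ?f 2 m) U"
    using sU by (intro infsum_mono summable_on_cmult_right)
  also have "\<dots> = (fact r + 1) powr (2 - s) * infsum (?f 2) U"
    by (rule infsum_cmult_right')
  \<comment> \<open>Restoring the term of \<open>m0\<close> only increases the sum.\<close>
  also have "\<dots> \<le> (fact r + 1) powr (2 - s) * multiple_zeta r 2"
    unfolding multiple_zeta_def
    using sU(2) sT by (intro mult_left_mono infsum_mono_neutral) (auto simp: U_def)
  finally show "multiple_zeta r s \<le> fact r powr - s + (fact r + 1) powr (2 - s) * multiple_zeta r 2"
    unfolding split by simp
qed

lemma multiple_zeta_normalized_tendsto:
  "((\<lambda>s. multiple_zeta r s / fact r powr - s) \<longlongrightarrow> 1) at_top"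
proof -
  define F :: real where "F = fact r"
  have F: "0 < F" by (simp add: F_def)
  \<comment> \<open>The square comes from \<open>(F + 1) powr (2 - s) / F powr - s = (F + 1)\<^sup>2
    * (F / (F + 1)) powr s\<close>.\<close>
  define C where "C = (F + 1)\<^sup>2 * multiple_zeta r 2"
  have "((\<lambda>s. (F / (F + 1)) powr s) \<longlongrightarrow> 0) at_top"
    using F by real_asymp
  then have upper: "((\<lambda>s. 1 + C * (F / (F + 1)) powr s) \<longlongrightarrow> 1) at_top"
    using tendsto_add[OF tendsto_const[of 1] tendsto_mult_right_zero[of _ at_top C]] by simp
  have bounds: "1 \<le> multiple_zeta r s / F powr - s \<and>
      multiple_zeta r s / F powr - s \<le> 1 + C * (F / (F + 1)) powr s" if "2 \<le> s" for s
  proof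
    show "1 \<le> multiple_zeta r s / F powr - s"
      using multiple_zeta_bounds(1)[OF that, of r] F by (simp add: F_def)
    have "multiple_zeta r s / F powr - s
        \<le> (F powr - s + (F + 1) powr (2 - s) * multiple_zeta r 2) / F powr - s"
      using multiple_zeta_bounds(2)[OF that, of r] by (intro divide_right_mono) (simp_all add: F_def)
    also have "\<dots> = 1 + C * (F / (F + 1)) powr s"
      using F by (simp add: C_def powr_diff powr_minus powr_divide field_simps)
    finally show "multiple_zeta r s / F powr - s \<le> 1 + C * (F / (F + 1)) powr s" .
  qed
  show ?thesis
    unfolding F_def[symmetric]
  proof (rule tendsto_sandwich[OF _ _ tendsto_const upper])
    show "\<forall>\<^sub>F s in at_top. 1 \<le> multiple_zeta r s / F powr - s"
      using eventually_ge_at_top[of 2] by eventually_elim (use bounds in blast)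
    show "\<forall>\<^sub>F s in at_top. multiple_zeta r s / F powr - s \<le> 1 + C * (F / (F + 1)) powr s"
      using eventually_ge_at_top[of 2] by eventually_elim (use bounds in blast)
  qed
qed

theorem theorem5:
  fixes r :: nat
  assumes "r \<ge> 1"
  shows "(\<lambda>s::real. multiple_zeta r s) \<sim>[at_top] (\<lambda>s::real. (fact r :: real) powr (- s))
    \<and> (\<lambda>k::nat. multiple_zeta r (real (k + 1)) / multiple_zeta r (real k))
        \<longlonglongrightarrow> 1 / (fact r :: real)"
proof
  let ?h = "\<lambda>s. multiple_zeta r s / fact r powr - s"
  show "(\<lambda>s. multiple_zeta r s) \<sim>[at_top] (\<lambda>s. (fact r :: real) powr - s)"
    by (rule asymp_equivI'[OF multiple_zeta_normalized_tendsto])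
  have lim: "(\<lambda>k. ?h (real k)) \<longlonglongrightarrow> 1"
    by (rule filterlim_compose[OF multiple_zeta_normalized_tendsto filterlim_real_sequentially])
  have "(\<lambda>k. ?h (real (k + 1)) / ?h (real k) * (1 / fact r)) \<longlonglongrightarrow> 1 / 1 * (1 / fact r)"
    using LIMSEQ_ignore_initial_segment[OF lim, of 1]
    by (intro tendsto_intros lim) simp_all
  \<comment> \<open>This identity is purely algebraic, so it also covers \<open>k = 0\<close> and
    \<open>k = 1\<close>, where the series diverges and \<open>multiple_zeta\<close> takes the
    default value 0.\<close>
  moreover have "?h (real (k + 1)) / ?h (real k) * (1 / fact r)
      = multiple_zeta r (real (k + 1)) / multiple_zeta r (real k)" for k
  proof -
    have step: "(fact r :: real) powr - real (k + 1) = fact r powr - real k / fact r"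
      using powr_diff[of "fact r :: real" "- real k" 1] by (simp add: minus_diff_commute)
    show ?thesis
      unfolding step by simp
  qed
  ultimately show "(\<lambda>k. multiple_zeta r (real (k + 1)) / multiple_zeta r (real k))
      \<longlonglongrightarrow> 1 / fact r"
    by simp
qed

end
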